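(* Let $\mathbb{F}_q$ be a finite field with $q$ elements and characteristic $p$, let $n,m,k,r$ be positive integers, and let $r=\sum_{t=0}^{s_r} r_t p^{t}$ be the base-$p$ expansion of $r$ (digits $0\le r_t\le p-1$). Put $$\gamma_{n,p}(r)=\prod_{t=0}^{s_r}\binom{r_t+n-1}{r_t}.$$ Then the neuromanifold satisfies $$|\mathcal{P}_{(n,m,k),r}(\mathbb{F}_q)|\le \left(q^{\gamma_{n,p}(r)}\right)^k .$$
   Context: For a field $\mathbb{F}$ and positive integers $n,r$, $S^r(\mathbb{F}^n)$ denotes the space of homogeneous polynomials of degree $r$ in $x_1,\dots,x_n$ over $\mathbb{F}$ (including $0$). For positive integers $n,m,k,r$, the neuromanifold $\mathcal{P}_{(n,m,k),r}(\mathbb{F})\subseteq (S^r(\mathbb{F}^n))^k$ is the set of all $k$-tuples of polynomials $(f_1,\dots,f_k)$ of the form $$f_i=\sum_{s=1}^m b_{is}(a_{s1}x_1+\dots+a_{sn}x_n)^r,\qquad i=1,\dots,k,$$ with $(a_{sj})\in\mathbb{F}^{m\times n}$ and $(b_{is})\in\mathbb{F}^{k\times m}$ arbitrary. Equality is equality of polynomials, not of functions on $\mathbb{F}^n$. *)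

theory Defs
  imports
    "HOL-Library.Poly_Mapping"
    "HOL-Library.FuncSet"
    "HOL-Library.Cardinality"
    "HOL-Computational_Algebra.Primes"
begin

text \<open>
  A polynomial is a finitely supported map from exponent vectors to coefficients, with the
  convolution product of \<^theory>\<open>HOL-Library.Poly_Mapping\<close>. Equality is thus equality of
  coefficients, not of the induced functions.
\<close>

type_synonym 'a mpoly = "(nat \<Rightarrow>\<^sub>0 nat) \<Rightarrow>\<^sub>0 'a"

definition var :: "nat \<Rightarrow> 'a::field mpoly"
  where "var j = Poly_Mapping.single (Poly_Mapping.single j 1) 1"

definition const :: "'a::field \<Rightarrow> 'a mpoly"
  where "const c = Poly_Mapping.single 0 c"

definition homogeneous_polys :: "nat \<Rightarrow> nat \<Rightarrow> 'a::field mpoly set"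
  where "homogeneous_polys n r =
    {f. \<forall>e\<in>Poly_Mapping.keys f. Poly_Mapping.keys e \<subseteq> {1..n} \<and>
          (\<Sum>j=1..n. Poly_Mapping.lookup e j) = r}"

definition linear_form :: "nat \<Rightarrow> (nat \<Rightarrow> 'a::field) \<Rightarrow> 'a mpoly"
  where "linear_form n c = (\<Sum>j=1..n. const (c j) * var j)"

text \<open>
  Matrices and \<open>k\<close>-tuples are functions on index ranges starting at 1. A \<open>k\<close>-tuple is restricted
  to \<open>{1..k}\<close>, so that two tuples are equal iff their \<open>k\<close> entries agree; entries of \<open>a\<close> and \<open>b\<close>
  outside the ranges \<open>{1..m} \<times> {1..n}\<close> and \<open>{1..k} \<times> {1..m}\<close> have no influence.
\<close>

definition network_tuple ::
  "nat \<Rightarrow> nat \<Rightarrow> nat \<Rightarrow> nat \<Rightarrow> (nat \<Rightarrow> nat \<Rightarrow> 'a::field) \<Rightarrow> (nat \<Rightarrow> nat \<Rightarrow> 'a) \<Rightarrow> nat \<Rightarrow> 'a mpoly"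
  where "network_tuple n m k r a b =
    (\<lambda>i\<in>{1..k}. \<Sum>s=1..m. const (b i s) * linear_form n (a s) ^ r)"

definition neuromanifold :: "nat \<Rightarrow> nat \<Rightarrow> nat \<Rightarrow> nat \<Rightarrow> (nat \<Rightarrow> 'a::field mpoly) set"
  where "neuromanifold n m k r = {network_tuple n m k r a b | a b. True}"

lemma homogeneous_polys_mult:
  assumes "f \<in> homogeneous_polys n r" and "g \<in> homogeneous_polys n s"
  shows "f * g \<in> homogeneous_polys n (r + s)"
proof -
  have "Poly_Mapping.keys e \<subseteq> {1..n} \<and> (\<Sum>j=1..n. Poly_Mapping.lookup e j) = r + s"
    if e: "e \<in> Poly_Mapping.keys (f * g)" for e
  proof -
    obtain u v where uv: "u \<in> Poly_Mapping.keys f" "v \<in> Poly_Mapping.keys g" "e = u + v"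
      using e keys_mult[of f g] by blast
    then show ?thesis
      using assms Poly_Mapping.keys_add[of u v]
      by (fastforce simp: homogeneous_polys_def lookup_add sum.distrib)
  qed
  then show ?thesis by (simp add: homogeneous_polys_def)
qed

lemma homogeneous_polys_sum:
  assumes "\<And>i. i \<in> I \<Longrightarrow> f i \<in> homogeneous_polys n r"
  shows "sum f I \<in> homogeneous_polys n r"
  using assms Poly_Mapping.keys_sum[of f I] by (fastforce simp: homogeneous_polys_def)

lemma const_homogeneous: "const c \<in> homogeneous_polys n 0"
  by (simp add: homogeneous_polys_def const_def)

lemma var_homogeneous: "j \<in> {1..n} \<Longrightarrow> var j \<in> homogeneous_polys n 1"
  by (simp add: homogeneous_polys_def var_def lookup_single when_def)

lemma linear_form_homogeneous: "linear_form n c \<in> homogeneous_polys n 1"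
  unfolding linear_form_def
  using homogeneous_polys_mult[OF const_homogeneous var_homogeneous]
  by (intro homogeneous_polys_sum) simp

lemma linear_form_power_homogeneous: "linear_form n c ^ r \<in> homogeneous_polys n r"
proof (induction r)
  case 0
  then show ?case using const_homogeneous[of 1 n] by (simp add: const_def)
next
  case (Suc r)
  then show ?case using homogeneous_polys_mult[OF linear_form_homogeneous Suc.IH] by simp
qed

lemma neuromanifold_subset:
  "neuromanifold n m k r \<subseteq> {1..k} \<rightarrow>\<^sub>E homogeneous_polys n r"
  using homogeneous_polys_mult[OF const_homogeneous linear_form_power_homogeneous]
  by (auto simp: neuromanifold_def network_tuple_def intro!: homogeneous_polys_sum)

end

theory Submission
  imports Defs
begin

text \<open>
  In characteristic \<open>p\<close> the Frobenius map is additive, so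
  \<open>\<ell> ^ r = (\<Prod>t. (\<Sum>j. a\<^sub>j ^ p ^ t * x\<^sub>j ^ p ^ t) ^ r\<^sub>t)\<close> for a linear form \<open>\<ell> = (\<Sum>j. a\<^sub>j * x\<^sub>j)\<close>.
  Hence every monomial of \<open>\<ell> ^ r\<close> has an exponent vector \<open>\<Sum>t. p ^ t * u\<^sub>t\<close> with \<open>u\<^sub>t\<close> of degree
  \<open>r\<^sub>t\<close>. There are at most \<open>\<gamma> = (\<Prod>t. (r\<^sub>t + n - 1) choose r\<^sub>t)\<close> such vectors, independently of
  \<open>\<ell>\<close>, and each of the \<open>k\<close> entries of a tuple is a polynomial supported on them.
\<close>

definition exponents :: "nat \<Rightarrow> nat \<Rightarrow> (nat \<Rightarrow>\<^sub>0 nat) set"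
  where "exponents n d = {e. Poly_Mapping.keys e \<subseteq> {1..n} \<and>
    (\<Sum>j=1..n. Poly_Mapping.lookup e j) = d}"

lemma zero_in_exponents: "0 \<in> exponents n 0"
  by (simp add: exponents_def)

lemma single_in_exponents: "j \<in> {1..n} \<Longrightarrow> Poly_Mapping.single j 1 \<in> exponents n 1"
  by (simp add: exponents_def lookup_single when_def)

lemma add_in_exponents:
  assumes "u \<in> exponents n d" and "v \<in> exponents n d'"
  shows "u + v \<in> exponents n (d + d')"
  using assms Poly_Mapping.keys_add[of u v]
  by (fastforce simp: exponents_def lookup_add sum.distrib)

text \<open>Stars and bars: listing the entries at the positions 1 to \<open>n\<close> embeds
  \<open>exponents n d\<close> into the lists of length \<open>n\<close> with sum
  \<open>d\<close>.\<close>

lemma exponents_card: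
  assumes "n \<ge> 1"
  shows finite_exponents: "finite (exponents n d)"
    and card_exponents_le: "card (exponents n d) \<le> (d + n - 1) choose d"
proof -
  define L where "L = {l::nat list. length l = n \<and> sum_list l = d}"
  define \<phi> where "\<phi> e = map (Poly_Mapping.lookup e) [1..<Suc n]" for e :: "nat \<Rightarrow>\<^sub>0 nat"
  have card_L: "card L = (d + n - 1) choose d"
    unfolding L_def by (rule card_length_sum_list)
  \<comment> \<open>The binomial coefficient is nonzero because \<open>n \<ge> 1\<close> gives
    \<open>d \<le> d + n - 1\<close>. As infinite sets have \<open>card\<close> 0, finiteness of
    \<open>L\<close> follows.\<close>
  then have "card L > 0"
    using assms by (simp add: zero_less_binomial_iff)
  then have fin: "finite L"
    by (rule card_ge_0_finite)
  have inj: "inj_on \<phi> (exponents n d)"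
  proof (rule inj_onI)
    fix u v assume uv: "u \<in> exponents n d" "v \<in> exponents n d" "\<phi> u = \<phi> v"
    have "Poly_Mapping.lookup u j = Poly_Mapping.lookup v j" for j
    proof (cases "j \<in> {1..n}")
      case True
      then show ?thesis using uv(3) by (auto simp: \<phi>_def)
    next
      case False
      then have "j \<notin> Poly_Mapping.keys u" "j \<notin> Poly_Mapping.keys v"
        using uv(1,2) by (auto simp: exponents_def)
      then show ?thesis by (simp add: in_keys_iff)
    qed
    then show "u = v" by (simp add: poly_mapping_eqI)
  qed
  have sub: "\<phi> ` exponents n d \<subseteq> L"
  proof
    fix l assume "l \<in> \<phi> ` exponents n d"
    then obtain e where e: "e \<in> exponents n d" "l = \<phi> e" by blast
    have "sum_list l = (\<Sum>j\<in>set [1..<Suc n]. Poly_Mapping.lookup e j)"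
      unfolding e(2) \<phi>_def by (rule sum_list_distinct_conv_sum_set) simp
    also have "set [1..<Suc n] = {1..n}" by auto
    finally show "l \<in> L" using e by (simp add: L_def \<phi>_def exponents_def)
  qed
  show "finite (exponents n d)"
    using inj sub fin by (rule inj_on_finite)
  show "card (exponents n d) \<le> (d + n - 1) choose d"
    using card_inj_on_le[OF inj sub fin] card_L by simp
qed

text \<open>
  Exponent vectors of type \<open>nat \<Rightarrow>\<^sub>0 nat\<close> themselves form a semiring under convolution, in which
  multiplication by \<open>of_nat N\<close> is scaling by \<open>N\<close>.
\<close>

lemma keys_power_subset_scaled_exponents:
  fixes g :: "'a::comm_semiring_1 mpoly" and c :: "nat \<Rightarrow>\<^sub>0 nat"
  assumes "Poly_Mapping.keys g \<subseteq> (*) c ` exponents n 1"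
  shows "Poly_Mapping.keys (g ^ d) \<subseteq> (*) c ` exponents n d"
proof (induction d)
  case 0
  have "(0 :: nat \<Rightarrow>\<^sub>0 nat) = c * 0" by simp
  then have "0 \<in> (*) c ` exponents n 0" using zero_in_exponents by blast
  then show ?case by simp
next
  case (Suc d)
  show ?case
  proof
    fix e assume "e \<in> Poly_Mapping.keys (g ^ Suc d)"
    then have "e \<in> Poly_Mapping.keys (g * g ^ d)" by simp
    then obtain x y where xy: "x \<in> Poly_Mapping.keys g" "y \<in> Poly_Mapping.keys (g ^ d)" "e = x + y"
      using keys_mult[of g "g ^ d"] by blast
    obtain u where u: "u \<in> exponents n 1" "x = c * u" using xy(1) assms by blast
    obtain v where v: "v \<in> exponents n d" "y = c * v" using xy(2) Suc.IH by blast
    have "e = c * (u + v)" using xy(3) u(2) v(2) by (simp add: distrib_left)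
    moreover have "u + v \<in> exponents n (Suc d)" using add_in_exponents[OF u(1) v(1)] by simp
    ultimately show "e \<in> (*) c ` exponents n (Suc d)" by blast
  qed
qed

text \<open>Each monomial of a product arises by choosing one monomial per factor and adding
  exponents. Recording the choices as elements of \<open>Pi\<^sub>E T K\<close> makes them easy to
  count.\<close>

lemma keys_prod_subset:
  fixes f :: "'i \<Rightarrow> ('b::comm_monoid_add \<Rightarrow>\<^sub>0 'a::comm_semiring_1)"
  assumes "finite T" and "\<And>t. t \<in> T \<Longrightarrow> Poly_Mapping.keys (f t) \<subseteq> K t"
  shows "Poly_Mapping.keys (prod f T) \<subseteq> (\<lambda>u. sum u T) ` Pi\<^sub>E T K"
  using assms
proof (induction T rule: finite_induct)
  case empty
  then show ?case by simp
next
  case (insert t T)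
  show ?case
  proof
    fix e assume "e \<in> Poly_Mapping.keys (prod f (insert t T))"
    then have "e \<in> Poly_Mapping.keys (f t * prod f T)" using insert.hyps by simp
    then obtain x y where xy: "x \<in> Poly_Mapping.keys (f t)" "y \<in> Poly_Mapping.keys (prod f T)"
      "e = x + y"
      using keys_mult[of "f t" "prod f T"] by blast
    obtain u where u: "u \<in> Pi\<^sub>E T K" "y = sum u T"
      using xy(2) insert.IH insert.prems by blast
    have "sum (u(t := x)) T = sum u T"
      using insert.hyps by (intro sum.cong) auto
    then have "e = sum (u(t := x)) (insert t T)"
      using insert.hyps xy(3) u(2) by simp
    moreover have "u(t := x) \<in> Pi\<^sub>E (insert t T) K"
      using u(1) xy(1) insert.prems by (intro PiE_fun_upd) auto
    ultimately show "e \<in> (\<lambda>u. sum u (insert t T)) ` Pi\<^sub>E (insert t T) K" by blast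
  qed
qed

lemma single_power:
  fixes a :: "'a::comm_semiring_1" and e :: "nat \<Rightarrow>\<^sub>0 nat"
  shows "Poly_Mapping.single e a ^ N = Poly_Mapping.single (of_nat N * e) (a ^ N)"
  by (induction N) (simp_all add: mult_single distrib_right)

text \<open>Natural numbers embed as constant polynomials, so they vanish in both rings
  simultaneously. This makes the Frobenius identity available for polynomials.\<close>

lemma CHAR_mpoly: "CHAR('a::field mpoly) = CHAR('a)"
proof -
  have "(of_nat N :: 'a mpoly) = 0 \<longleftrightarrow> (of_nat N :: 'a) = 0" for N
    unfolding single_of_nat[symmetric] by (metis lookup_single_eq lookup_zero single_zero)
  then show ?thesis
    by (intro CHAR_eqI) (simp_all add: of_nat_eq_0_iff_char_dvd)
qed

lemma keys_linear_form_power_char: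
  fixes c :: "nat \<Rightarrow> 'a::field"
  assumes "prime CHAR('a)"
  shows "Poly_Mapping.keys (linear_form n c ^ CHAR('a) ^ t) \<subseteq>
    (*) (of_nat (CHAR('a) ^ t)) ` exponents n 1"
proof -
  let ?N = "CHAR('a) ^ t"
  let ?g = "\<lambda>j. Poly_Mapping.single (of_nat ?N * Poly_Mapping.single j 1) (c j ^ ?N)"
  have "linear_form n c ^ ?N = (\<Sum>j=1..n. (const (c j) * var j) ^ ?N)"
    unfolding linear_form_def using assms
    by (intro freshmans_dream_sum'[where n = t]) (simp_all add: CHAR_mpoly)
  also have "\<dots> = (\<Sum>j=1..n. ?g j)"
    by (simp add: const_def var_def mult_single single_power del: of_nat_power)
  finally have "Poly_Mapping.keys (linear_form n c ^ ?N) \<subseteq> (\<Union>j\<in>{1..n}. Poly_Mapping.keys (?g j))"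
    by (simp only: Poly_Mapping.keys_sum)
  \<comment> \<open>Only an inclusion: a term with \<open>c j = 0\<close> has no keys.\<close>
  also have "\<dots> \<subseteq> (\<Union>j\<in>{1..n}. {of_nat ?N * Poly_Mapping.single j 1})"
    by (intro UN_mono) simp_all
  also have "\<dots> \<subseteq> (*) (of_nat ?N) ` exponents n 1"
    using single_in_exponents by blast
  finally show ?thesis .
qed

text \<open>An image of a product of sets, so that bounding its size reduces to bounding the size of
  each factor.\<close>

definition digit_exponents :: "nat \<Rightarrow> nat \<Rightarrow> nat \<Rightarrow> (nat \<Rightarrow> nat) \<Rightarrow> (nat \<Rightarrow>\<^sub>0 nat) set"
  where "digit_exponents n p s d =
    (\<lambda>u. sum u {0..s}) ` (\<Pi>\<^sub>E t\<in>{0..s}. (*) (of_nat (p ^ t)) ` exponents n (d t))"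

text \<open>Splitting the exponent along \<open>d\<close> turns the power into a product of powers
  of Frobenius images. The bounding set does not depend on \<open>c\<close>, so it serves all linear
  forms at once.\<close>

lemma keys_linear_form_power:
  fixes c :: "nat \<Rightarrow> 'a::field"
  assumes "prime CHAR('a)"
  shows "Poly_Mapping.keys (linear_form n c ^ (\<Sum>t=0..s. d t * CHAR('a) ^ t)) \<subseteq>
    digit_exponents n CHAR('a) s d"
proof -
  have "linear_form n c ^ (\<Sum>t=0..s. d t * CHAR('a) ^ t) =
      (\<Prod>t=0..s. (linear_form n c ^ CHAR('a) ^ t) ^ d t)"
    by (simp add: power_sum mult.commute flip: power_mult)
  then show ?thesis
    unfolding digit_exponents_def
    by (simp only: keys_prod_subset[OF finite_atLeastAtMost
          keys_power_subset_scaled_exponents[OF keys_linear_form_power_char[OF assms]]])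
qed

lemma digit_exponents_card:
  assumes "n \<ge> 1"
  shows finite_digit_exponents: "finite (digit_exponents n p s d)"
    and card_digit_exponents_le:
      "card (digit_exponents n p s d) \<le> (\<Prod>t=0..s. (d t + n - 1) choose (d t))"
proof -
  let ?K = "\<lambda>t. (*) (of_nat (p ^ t)) ` exponents n (d t)"
  have fin: "finite (Pi\<^sub>E {0..s} ?K)"
    using finite_exponents[OF assms] by (intro finite_PiE) auto
  then show "finite (digit_exponents n p s d)"
    by (simp add: digit_exponents_def)
  have "card (digit_exponents n p s d) \<le> card (Pi\<^sub>E {0..s} ?K)"
    unfolding digit_exponents_def by (rule card_image_le[OF fin])
  also have "\<dots> = (\<Prod>t=0..s. card (?K t))"
    by (simp add: card_PiE)
  also have "\<dots> \<le> (\<Prod>t=0..s. (d t + n - 1) choose (d t))"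
    by (intro prod_mono conjI zero_le
        order_trans[OF card_image_le[OF finite_exponents[OF assms]] card_exponents_le[OF assms]])
  finally show "card (digit_exponents n p s d) \<le> (\<Prod>t=0..s. (d t + n - 1) choose (d t))" .
qed

text \<open>A polynomial supported on \<open>E\<close> is determined by its coefficients there, each
  with \<open>CARD('a)\<close> possible values.\<close>

lemma supported_polys_card:
  fixes E :: "'b set"
  assumes "finite E"
  defines "P \<equiv> {f :: 'b \<Rightarrow>\<^sub>0 'a::{zero,finite}. Poly_Mapping.keys f \<subseteq> E}"
  shows finite_supported_polys: "finite P"
    and card_supported_polys_le: "card P \<le> CARD('a) ^ card E"
proof -
  define \<phi> where "\<phi> f = restrict (Poly_Mapping.lookup f) E" for f :: "'b \<Rightarrow>\<^sub>0 'a"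
  have inj: "inj_on \<phi> P"
  proof (rule inj_onI)
    fix f g assume fg: "f \<in> P" "g \<in> P" "\<phi> f = \<phi> g"
    have "Poly_Mapping.lookup f e = Poly_Mapping.lookup g e" for e
    proof (cases "e \<in> E")
      case True
      then show ?thesis using fun_cong[OF fg(3), of e] by (simp add: \<phi>_def)
    next
      case False
      then have "e \<notin> Poly_Mapping.keys f" "e \<notin> Poly_Mapping.keys g"
        using fg(1,2) by (auto simp: P_def)
      then show ?thesis by (simp add: in_keys_iff)
    qed
    then show "f = g" by (simp add: poly_mapping_eqI)
  qed
  have sub: "\<phi> ` P \<subseteq> E \<rightarrow>\<^sub>E UNIV"
    by (auto simp: \<phi>_def)
  have fin: "finite (E \<rightarrow>\<^sub>E (UNIV :: 'a set))"
    using assms(1) by (intro finite_PiE) auto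
  show "finite P"
    using inj sub fin by (rule inj_on_finite)
  show "card P \<le> CARD('a) ^ card E"
    using card_inj_on_le[OF inj sub fin] assms(1) by (simp add: card_PiE)
qed

theorem proposition2p5:
  fixes n m k r p q s\<^sub>r :: nat and d :: "nat \<Rightarrow> nat"
  assumes "CARD('a::finite_field) = q" and "CHAR('a) = p"
    and "n \<ge> 1" and "m \<ge> 1" and "k \<ge> 1" and "r \<ge> 1"
    and "\<forall>t\<in>{0..s\<^sub>r}. d t \<le> p - 1"
    and "r = (\<Sum>t=0..s\<^sub>r. d t * p ^ t)"
  shows "finite (neuromanifold n m k r :: (nat \<Rightarrow> 'a mpoly) set) \<and>
    card (neuromanifold n m k r :: (nat \<Rightarrow> 'a mpoly) set)
      \<le> (q ^ (\<Prod>t=0..s\<^sub>r. (d t + n - 1) choose (d t))) ^ k"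
proof -
  define E where "E = digit_exponents n p s\<^sub>r d"
  define P where "P = {f :: 'a mpoly. Poly_Mapping.keys f \<subseteq> E}"
  have fin_E: "finite E"
    unfolding E_def by (rule finite_digit_exponents[OF assms(3)])
  have fin_P: "finite P"
    unfolding P_def by (rule finite_supported_polys[OF fin_E])
  \<comment> \<open>A finite field has positive characteristic, which is prime since a field is an
    integral domain.\<close>
  have power_in_P: "Poly_Mapping.keys (linear_form n c ^ r) \<subseteq> E" for c :: "nat \<Rightarrow> 'a"
    using keys_linear_form_power[of n c d s\<^sub>r] prime_CHAR_semidom[where ?'a = 'a] CHAR_pos[where ?'a = 'a]
    unfolding E_def assms(8) assms(2)[symmetric] by blast
  \<comment> \<open>The only possible key of a constant is 0, so multiplying by it creates no new
    exponent.\<close>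
  have scale_in_P: "Poly_Mapping.keys (const b * linear_form n c ^ r) \<subseteq> E"
    for b :: 'a and c :: "nat \<Rightarrow> 'a"
    using keys_mult[of "const b" "linear_form n c ^ r"] power_in_P[of c]
    by (fastforce simp: const_def split: if_splits)
  have "(\<Sum>s=1..m. const (b s) * linear_form n (a s) ^ r) \<in> P"
    for b :: "nat \<Rightarrow> 'a" and a :: "nat \<Rightarrow> nat \<Rightarrow> 'a"
    using Poly_Mapping.keys_sum[of "\<lambda>s. const (b s) * linear_form n (a s) ^ r" "{1..m}"] scale_in_P
    unfolding P_def by blast
  then have sub: "neuromanifold n m k r \<subseteq> {1..k} \<rightarrow>\<^sub>E P"
    by (auto simp: neuromanifold_def network_tuple_def)
  have fin: "finite ({1..k} \<rightarrow>\<^sub>E P)"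
    using fin_P by (intro finite_PiE) auto
  have "card (neuromanifold n m k r :: (nat \<Rightarrow> 'a mpoly) set) \<le> card P ^ k"
    using card_mono[OF fin sub] by (simp add: card_PiE)
  also have "\<dots> \<le> (q ^ card E) ^ k"
    unfolding P_def assms(1)[symmetric]
    by (intro power_mono card_supported_polys_le[OF fin_E]) simp
  \<comment> \<open>Monotonicity in the exponent requires \<open>q \<ge> 1\<close>, which holds
    because a finite type has positive cardinality.\<close>
  also have "\<dots> \<le> (q ^ (\<Prod>t=0..s\<^sub>r. (d t + n - 1) choose (d t))) ^ k"
    using card_digit_exponents_le[OF assms(3)] assms(1)
    unfolding E_def by (intro power_mono power_increasing) (auto simp: Suc_le_eq)
  finally show ?thesis
    using finite_subset[OF sub fin] by blast
qed

end
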